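(* Let $D=(d_{ij})$ be an $n\times n$ Euclidean distance matrix of embedding dimension $r\le n-3$. If $D$ is in general position in $\mathbb{R}^r$, then every off-diagonal entry of $D$ is unyielding.
   Context: An $n\times n$ real matrix $D=(d_{ij})$ is a Euclidean distance matrix (EDM) if there exist points $p^1,\ldots,p^n$ in some Euclidean space with $d_{ij}=\|p^i-p^j\|^2$ for all $i,j$; such points are generating points of $D$, and the dimension of their affine span is the embedding dimension $r$ of $D$ (the generating points can be taken in $\mathbb{R}^r$). For $i\ne j$, $E^{ij}$ is the $n\times n$ symmetric matrix with 1's in the $ij$th and $ji$th entries and 0's elsewhere. For an off-diagonal entry $d_{ij}$, let $[l_{ij},u_{ij}]$ (with $l_{ij}\le 0\le u_{ij}$) be the closed interval such that $D+tE^{ij}$ is an EDM if and only if $l_{ij}\le t\le u_{ij}$. The entry $d_{ij}$ is unyielding if $l_{ij}=u_{ij}=0$, and yielding if $l_{ij}\ne u_{ij}$. Points $p^1,\ldots,p^n$ in $\mathbb{R}^r$ are in general position if every $r+1$ of them are affinely independent (as an indexed family). An EDM of embedding dimension $r$ is in general position if its generating points in $\mathbb{R}^r$ are in general position. *)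

theory Defs
  imports Complex_Main "Jordan_Normal_Form.VS_Connect"
begin

text \<open>
  Points of the Euclidean space of dimension \<open>k\<close> are real vectors in \<open>carrier_vec k\<close>, and a point
  configuration is an indexed family \<open>p 0, \<dots>, p (n - 1)\<close>, so repeated points are allowed. Explicit
  carriers are used because the dimension is existentially quantified below, and \<open>k = 0\<close> occurs.
\<close>

definition generating_points :: "nat \<Rightarrow> real mat \<Rightarrow> nat \<Rightarrow> (nat \<Rightarrow> real vec) \<Rightarrow> bool" where
  "generating_points n D k p \<longleftrightarrow>
     D \<in> carrier_mat n n \<and>
     (\<forall>i<n. p i \<in> carrier_vec k) \<and>
     (\<forall>i<n. \<forall>j<n. D $$ (i, j) = (p i - p j) \<bullet> (p i - p j))"

definition is_EDM :: "nat \<Rightarrow> real mat \<Rightarrow> bool" where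
  "is_EDM n D \<longleftrightarrow> (\<exists>k p. generating_points n D k p)"

definition affine_span :: "nat \<Rightarrow> nat \<Rightarrow> (nat \<Rightarrow> real vec) \<Rightarrow> real vec set" where
  "affine_span k n p =
     {finsum_vec TYPE(real) k (\<lambda>i. c i \<cdot>\<^sub>v p i) {..<n} | c. (\<Sum>i<n. c i) = 1}"

text \<open>The dimension of an affine subspace is the dimension of its direction space.\<close>

definition affine_dim :: "nat \<Rightarrow> real vec set \<Rightarrow> nat" where
  "affine_dim k A =
     vectorspace.dim class_ring
       (module_vec TYPE(real) k
          \<lparr>carrier := LinearCombinations.module.span class_ring (module_vec TYPE(real) k)
                       {x - y | x y. x \<in> A \<and> y \<in> A}\<rparr>)"

text \<open>
  A relation rather than a function: generating points are unique up to isometry, so at most one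
  \<open>r\<close> qualifies.
\<close>

definition has_embedding_dim :: "nat \<Rightarrow> real mat \<Rightarrow> nat \<Rightarrow> bool" where
  "has_embedding_dim n D r \<longleftrightarrow>
     (\<exists>k p. generating_points n D k p \<and> affine_dim k (affine_span k n p) = r)"

definition affinely_independent :: "nat \<Rightarrow> (nat \<Rightarrow> real vec) \<Rightarrow> nat set \<Rightarrow> bool" where
  "affinely_independent k p I \<longleftrightarrow>
     (\<forall>c. (\<Sum>i\<in>I. c i) = 0 \<and> finsum_vec TYPE(real) k (\<lambda>i. c i \<cdot>\<^sub>v p i) I = 0\<^sub>v k
        \<longrightarrow> (\<forall>i\<in>I. c i = 0))"

definition in_general_position :: "nat \<Rightarrow> nat \<Rightarrow> (nat \<Rightarrow> real vec) \<Rightarrow> bool" where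
  "in_general_position n r p \<longleftrightarrow>
     (\<forall>I. I \<subseteq> {..<n} \<and> card I = r + 1 \<longrightarrow> affinely_independent r p I)"

text \<open>
  Two families of generating points of \<open>D\<close> in dimension \<open>r\<close> differ by an isometry of the whole space,
  which preserves general position; so \<open>\<exists>p\<close> says the same as \<open>\<forall>p\<close> here.
\<close>

definition EDM_in_general_position :: "nat \<Rightarrow> real mat \<Rightarrow> nat \<Rightarrow> bool" where
  "EDM_in_general_position n D r \<longleftrightarrow>
     has_embedding_dim n D r \<and> (\<exists>p. generating_points n D r p \<and> in_general_position n r p)"

definition E_mat :: "nat \<Rightarrow> nat \<Rightarrow> nat \<Rightarrow> real mat" where
  "E_mat n i j =
     mat n n (\<lambda>(a, b). if (a = i \<and> b = j) \<or> (a = j \<and> b = i) then 1 else 0)"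

definition yielding_interval :: "nat \<Rightarrow> real mat \<Rightarrow> nat \<Rightarrow> nat \<Rightarrow> real \<Rightarrow> real \<Rightarrow> bool" where
  "yielding_interval n D i j l u \<longleftrightarrow>
     l \<le> 0 \<and> 0 \<le> u \<and> (\<forall>t. is_EDM n (D + t \<cdot>\<^sub>m E_mat n i j) \<longleftrightarrow> l \<le> t \<and> t \<le> u)"

definition unyielding :: "nat \<Rightarrow> real mat \<Rightarrow> nat \<Rightarrow> nat \<Rightarrow> bool" where
  "unyielding n D i j \<longleftrightarrow> (\<exists>l u. yielding_interval n D i j l u \<and> l = 0 \<and> u = 0)"

end

theory Submission
  imports Defs
begin

text \<open>
  Changing the single distance between the points \<open>i\<close> and \<open>j\<close> is impossible because the other
  distances already determine it. Since \<open>n \<ge> r + 3\<close>, there are \<open>r + 1\<close> further points \<open>p a\<close> with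
  \<open>a \<in> I\<close>, and the \<open>r + 2\<close> points indexed by \<open>S = insert i I\<close>, which all lie in dimension \<open>r\<close>,
  satisfy a nontrivial affine dependency \<open>c\<close>. General position forces \<open>c i \<noteq> 0\<close>
  (lemma \<open>general_position_dependency\<close>).

  Let \<open>q\<close> generate the perturbed matrix \<open>D + t E\<close>. The pair \<open>(i, j)\<close> does not occur inside \<open>S\<close>, so \<open>p\<close>
  and \<open>q\<close> have the same mutual distances on \<open>S\<close>. Weights of sum zero are an affine dependency iff
  the quadratic form given by the squared distances vanishes on them, so \<open>c\<close> is an affine dependency of the points \<open>q a\<close>
  as well (lemma \<open>affine_dependency_isometric\<close>).

  For an affine dependency the weighted sum of squared distances \<open>\<Sum>a\<in>S. c a * sqdist (p a) z\<close> is the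
  same for every \<open>z\<close> (lemma \<open>affine_dependency_sqdist_const\<close>). Comparing \<open>z = p j\<close> with \<open>z = p m\<close> for
  some \<open>m \<in> I\<close>, and likewise for \<open>q\<close>, only the term belonging to the pair \<open>(i, j)\<close> differs between the two
  configurations, and it differs by \<open>c i * t\<close>. Hence \<open>c i * t = 0\<close> and \<open>t = 0\<close>.
\<close>

text \<open>
  The vector condition is imposed coordinatewise, which reduces all computations with dependencies to
  finite sums of real numbers.
\<close>

definition affine_dependency :: "nat \<Rightarrow> ('a \<Rightarrow> real vec) \<Rightarrow> 'a set \<Rightarrow> ('a \<Rightarrow> real) \<Rightarrow> bool" where
  "affine_dependency k p S c \<longleftrightarrow>
     (\<Sum>a\<in>S. c a) = 0 \<and> (\<forall>x<k. (\<Sum>a\<in>S. c a * p a $ x) = 0)"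

abbreviation sqdist :: "real vec \<Rightarrow> real vec \<Rightarrow> real" where
  "sqdist u v \<equiv> (u - v) \<bullet> (u - v)"

lemma sqdist_coordinates:
  assumes "u \<in> carrier_vec k" "v \<in> carrier_vec k"
  shows "sqdist u v = (\<Sum>x<k. (u $ x - v $ x)\<^sup>2)"
  using assms by (auto simp: scalar_prod_def power2_eq_square lessThan_atLeast0 intro!: sum.cong)

text \<open>
  Expanding the square of \<open>p a - z\<close>, the contribution of the squared norm of \<open>z\<close> cancels because the
  weights sum to zero. What remains is affine in \<open>z\<close>, with linear part the weighted sum of the points.
\<close>

lemma weighted_sqdist:
  assumes p: "\<And>a. a \<in> S \<Longrightarrow> p a \<in> carrier_vec k" and z: "z \<in> carrier_vec k"
    and c: "(\<Sum>a\<in>S. c a) = 0"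
  shows "(\<Sum>a\<in>S. c a * sqdist (p a) z) =
         (\<Sum>a\<in>S. c a * (\<Sum>x<k. (p a $ x)\<^sup>2)) - 2 * (\<Sum>x<k. (\<Sum>a\<in>S. c a * p a $ x) * z $ x)"
proof -
  let ?N = "\<lambda>a. \<Sum>x<k. (p a $ x)\<^sup>2" and ?Z = "\<Sum>x<k. (z $ x)\<^sup>2"
  have "(\<Sum>a\<in>S. c a * sqdist (p a) z) =
        (\<Sum>a\<in>S. c a * ?N a - 2 * (\<Sum>x<k. c a * p a $ x * z $ x) + c a * ?Z)"
  proof (rule sum.cong[OF refl])
    fix a assume "a \<in> S"
    then have "sqdist (p a) z = (\<Sum>x<k. (p a $ x)\<^sup>2 - 2 * (p a $ x * z $ x) + (z $ x)\<^sup>2)"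
      by (subst sqdist_coordinates[OF p z]) (auto simp: power2_diff algebra_simps intro!: sum.cong)
    also have "\<dots> = ?N a - 2 * (\<Sum>x<k. p a $ x * z $ x) + ?Z"
      by (simp add: sum.distrib sum_subtractf sum_distrib_left)
    finally have "sqdist (p a) z = ?N a - 2 * (\<Sum>x<k. p a $ x * z $ x) + ?Z" .
    then show "c a * sqdist (p a) z =
        c a * ?N a - 2 * (\<Sum>x<k. c a * p a $ x * z $ x) + c a * ?Z"
      by (simp add: distrib_left right_diff_distrib sum_distrib_left mult_ac)
  qed
  also have "\<dots> = (\<Sum>a\<in>S. c a * ?N a) - 2 * (\<Sum>a\<in>S. \<Sum>x<k. c a * p a $ x * z $ x)
      + (\<Sum>a\<in>S. c a) * ?Z"
    by (simp add: sum.distrib sum_subtractf flip: sum_distrib_left sum_distrib_right)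
  also have "(\<Sum>a\<in>S. \<Sum>x<k. c a * p a $ x * z $ x) = (\<Sum>x<k. (\<Sum>a\<in>S. c a * p a $ x) * z $ x)"
    by (subst sum.swap) (simp add: sum_distrib_right)
  finally show ?thesis using c by simp
qed

text \<open>
  For an affine dependency the linear part in \<open>weighted_sqdist\<close> vanishes too.
\<close>

lemma affine_dependency_sqdist_const:
  assumes "\<And>a. a \<in> S \<Longrightarrow> p a \<in> carrier_vec k" "affine_dependency k p S c"
    and "z \<in> carrier_vec k" "w \<in> carrier_vec k"
  shows "(\<Sum>a\<in>S. c a * sqdist (p a) z) = (\<Sum>a\<in>S. c a * sqdist (p a) w)"
proof -
  have c: "(\<Sum>a\<in>S. c a) = 0" "\<And>x. x < k \<Longrightarrow> (\<Sum>a\<in>S. c a * p a $ x) = 0"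
    using assms(2) by (auto simp: affine_dependency_def)
  have "(\<Sum>a\<in>S. c a * sqdist (p a) v) = (\<Sum>a\<in>S. c a * (\<Sum>x<k. (p a $ x)\<^sup>2))"
    if v: "v \<in> carrier_vec k" for v
    by (subst weighted_sqdist[OF _ v c(1)]) (simp_all add: assms(1) c(2))
  with assms(3,4) show ?thesis by presburger
qed

text \<open>
  This is the identity of Schoenberg: on weights of sum zero, the quadratic form of a distance
  matrix is minus twice a squared norm. It follows by summing \<open>weighted_sqdist\<close> with \<open>z = p b\<close>
  against the same weights.
\<close>

lemma sqdist_quadratic_form:
  assumes p: "\<And>a. a \<in> S \<Longrightarrow> p a \<in> carrier_vec k" and c: "(\<Sum>a\<in>S. c a) = 0"
  shows "(\<Sum>b\<in>S. c b * (\<Sum>a\<in>S. c a * sqdist (p a) (p b))) =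
         - 2 * (\<Sum>x<k. (\<Sum>a\<in>S. c a * p a $ x)\<^sup>2)"
proof -
  let ?N = "\<Sum>a\<in>S. c a * (\<Sum>x<k. (p a $ x)\<^sup>2)" and ?s = "\<lambda>x. \<Sum>a\<in>S. c a * p a $ x"
  have "(\<Sum>b\<in>S. c b * (\<Sum>a\<in>S. c a * sqdist (p a) (p b))) =
        (\<Sum>b\<in>S. c b * ?N - 2 * (\<Sum>x<k. ?s x * (c b * p b $ x)))"
    using weighted_sqdist[of S p k _ c] p c
    by (intro sum.cong) (auto simp: right_diff_distrib sum_distrib_left mult_ac)
  also have "\<dots> = (\<Sum>b\<in>S. c b) * ?N - 2 * (\<Sum>b\<in>S. \<Sum>x<k. ?s x * (c b * p b $ x))"
    by (simp add: sum_subtractf flip: sum_distrib_left sum_distrib_right)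
  also have "(\<Sum>b\<in>S. \<Sum>x<k. ?s x * (c b * p b $ x)) = (\<Sum>x<k. (?s x)\<^sup>2)"
    by (subst sum.swap) (simp add: power2_eq_square flip: sum_distrib_left)
  finally show ?thesis using c by simp
qed

lemma affine_dependency_iff_quadratic_form:
  assumes "\<And>a. a \<in> S \<Longrightarrow> p a \<in> carrier_vec k"
  shows "affine_dependency k p S c \<longleftrightarrow>
    (\<Sum>a\<in>S. c a) = 0 \<and> (\<Sum>b\<in>S. c b * (\<Sum>a\<in>S. c a * sqdist (p a) (p b))) = 0"
  using sqdist_quadratic_form[of S p k c] assms
  by (auto simp: affine_dependency_def sum_nonneg_eq_0_iff)

text \<open>
  The quadratic form only sees distances, so dependencies are invariant under
  isometry of the configurations, even when these live in different dimensions.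
\<close>

lemma affine_dependency_isometric:
  assumes "\<And>a. a \<in> S \<Longrightarrow> p a \<in> carrier_vec k" "\<And>a. a \<in> S \<Longrightarrow> q a \<in> carrier_vec m"
    and "\<And>a b. a \<in> S \<Longrightarrow> b \<in> S \<Longrightarrow> sqdist (p a) (p b) = sqdist (q a) (q b)"
    and "affine_dependency k p S c"
  shows "affine_dependency m q S c"
proof -
  have "(\<Sum>b\<in>S. c b * (\<Sum>a\<in>S. c a * sqdist (q a) (q b))) =
        (\<Sum>b\<in>S. c b * (\<Sum>a\<in>S. c a * sqdist (p a) (p b)))"
    using assms(3) by simp
  with assms(4) show ?thesis
    by (simp add: affine_dependency_iff_quadratic_form[of S p] assms(1)
        affine_dependency_iff_quadratic_form[of S q] assms(2))
qed

text \<open>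
  An affine dependency is a kernel vector of the matrix with columns \<open>(p a, 1)\<close>, which has one
  more column than rows. Padding it by a zero row makes it square with determinant zero, so a nonzero
  kernel vector exists.
\<close>

lemma affine_dependency_exists:
  fixes p :: "'a \<Rightarrow> real vec"
  assumes "card S = r + 2"
  obtains c a where "affine_dependency r p S c" "a \<in> S" "c a \<noteq> 0"
proof -
  let ?n = "r + 2"
  have "finite S"
    using assms by (auto intro: card_ge_0_finite)
  then obtain e where e: "bij_betw e {0..<?n} S"
    using ex_bij_betw_nat_finite[of S] assms by auto
  define A where "A = mat ?n ?n
    (\<lambda>(x, a). if x < r then p (e a) $ x else if x = r then 1 else (0::real))"
  have A: "A \<in> carrier_mat ?n ?n"
    by (simp add: A_def)
  have row: "row A x \<bullet> v = (\<Sum>a\<in>{0..<?n}. A $$ (x, a) * v $ a)"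
    if "x < ?n" "v \<in> carrier_vec ?n" for x v
    using that A by (auto simp: scalar_prod_def intro!: sum.cong)
  \<comment> \<open>Row \<open>r\<close> of ones encodes that the weights sum to zero; row \<open>r + 1\<close> is the zero padding.\<close>
  have "det A = 0"
    by (subst laplace_expansion_row[OF A, of "r + 1"]) (auto simp: A_def)
  then obtain v where v: "v \<in> carrier_vec ?n" "v \<noteq> 0\<^sub>v ?n" "A *\<^sub>v v = 0\<^sub>v ?n"
    using det_0_iff_vec_prod_zero_field[OF A] by auto
  have rows: "(\<Sum>a\<in>{0..<?n}. A $$ (x, a) * v $ a) = 0" if "x < ?n" for x
    using row[OF that v(1)] v(3) that A by (metis carrier_matD(1) index_mult_mat_vec index_zero_vec(1))
  define c where "c = (\<lambda>a. v $ the_inv_into {0..<?n} e a)"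
  have c: "c (e a) = v $ a" if "a < ?n" for a
    using that e by (simp add: c_def bij_betw_def the_inv_into_f_f)
  have reindex: "(\<Sum>a\<in>S. g a) = (\<Sum>a\<in>{0..<?n}. g (e a))" for g :: "'a \<Rightarrow> real"
    using sum.reindex_bij_betw[OF e, of g] by simp
  have "affine_dependency r p S c"
    unfolding affine_dependency_def
  proof (intro conjI allI impI)
    show "(\<Sum>a\<in>S. c a) = 0"
      using rows[of r] by (simp add: reindex c A_def cong: sum.cong_simp)
    fix x assume "x < r"
    then show "(\<Sum>a\<in>S. c a * p a $ x) = 0"
      using rows[of x] by (simp add: reindex c A_def mult.commute cong: sum.cong_simp)
  qed
  moreover obtain a where "a < ?n" "v $ a \<noteq> 0"
    using v(1,2) by (metis eq_vecI carrier_vecD index_zero_vec)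
  moreover have "e a \<in> S"
    using e \<open>a < ?n\<close> by (auto simp: bij_betw_def)
  ultimately show thesis
    using that[of c "e a"] c by simp
qed

lemma affinely_independent_dependency_zero:
  assumes "affinely_independent k p I" "affine_dependency k p I c"
    and "finite I" "\<And>a. a \<in> I \<Longrightarrow> p a \<in> carrier_vec k" "a \<in> I"
  shows "c a = 0"
proof -
  have "finsum_vec TYPE(real) k (\<lambda>i. c i \<cdot>\<^sub>v p i) I = 0\<^sub>v k" (is "?f = _")
  proof (rule eq_vecI)
    have "?f \<in> carrier_vec k"
      using assms by (intro finsum_vec_closed) auto
    then show "dim_vec ?f = dim_vec (0\<^sub>v k)" by simp
    fix x assume "x < dim_vec (0\<^sub>v k :: real vec)"
    then have x: "x < k" by simp
    have "?f $ x = (\<Sum>i\<in>I. (c i \<cdot>\<^sub>v p i) $ x)"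
      using assms x by (subst index_finsum_vec) auto
    also have "\<dots> = (\<Sum>i\<in>I. c i * p i $ x)"
    proof (rule sum.cong[OF refl])
      fix i assume "i \<in> I"
      with assms(4) x show "(c i \<cdot>\<^sub>v p i) $ x = c i * p i $ x"
        by (metis carrier_vecD index_smult_vec(1))
    qed
    finally show "?f $ x = 0\<^sub>v k $ x"
      using assms(2) x by (simp add: affine_dependency_def)
  qed
  with assms show ?thesis
    by (auto simp: affinely_independent_def affine_dependency_def)
qed

text \<open>
  If a weight vanished, deleting its point would leave a nontrivial dependency among \<open>r + 1\<close> points,
  against general position.
\<close>

lemma general_position_dependency:
  assumes p: "\<And>a. a < n \<Longrightarrow> p a \<in> carrier_vec r" and gen: "in_general_position n r p"
    and S: "S \<subseteq> {..<n}" "card S = r + 2"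
  obtains c where "affine_dependency r p S c" "\<And>a. a \<in> S \<Longrightarrow> c a \<noteq> 0"
proof -
  obtain c b where c: "affine_dependency r p S c" and b: "b \<in> S" "c b \<noteq> 0"
    using affine_dependency_exists[OF S(2)] by blast
  have fin: "finite S"
    using S(1) finite_subset by blast
  have "c a \<noteq> 0" if "a \<in> S" for a
  proof
    assume "c a = 0"
    then have "affine_dependency r p (S - {a}) c"
      using c fin that by (simp add: affine_dependency_def sum_diff1)
    moreover have "S - {a} \<subseteq> {..<n}" "card (S - {a}) = r + 1"
      using S that by auto
    then have "affinely_independent r p (S - {a})"
      using gen unfolding in_general_position_def by blast
    moreover have "b \<in> S - {a}"
      using b \<open>c a = 0\<close> by auto
    ultimately have "c b = 0"
      using p S(1) fin by (intro affinely_independent_dependency_zero[of r p "S - {a}"]) auto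
    with b show False by simp
  qed
  with c show thesis by (rule that)
qed

text \<open>
  Here \<open>j\<close> is kept outside the dependent set \<open>S\<close> while \<open>i\<close> belongs to it: distances inside \<open>S\<close> are
  then unchanged, and \<open>t\<close> enters the weighted sum of distances to point \<open>j\<close> in exactly one term.
\<close>

lemma general_position_perturbation_zero:
  assumes p: "generating_points n D r p" "in_general_position n r p" and n: "r + 3 \<le> n"
    and ij: "i < n" "j < n" "i \<noteq> j" and q: "generating_points n (D + t \<cdot>\<^sub>m E_mat n i j) k q"
  shows "t = 0"
proof -
  have "r + 1 \<le> card ({..<n} - {i, j})"
    using n ij by (simp add: card_Diff_subset)
  then obtain I where I: "I \<subseteq> {..<n} - {i, j}" "card I = r + 1"
    by (meson obtain_subset_with_card_n)
  define S where "S = insert i I"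
  have fin: "finite I"
    using I(1) finite_subset by blast
  have S: "S \<subseteq> {..<n}" "j \<notin> S" "finite S" "card S = r + 2"
    using I ij fin by (auto simp: S_def card_insert_if)
  obtain m where m: "m \<in> I"
    using I(2) by fastforce
  have lt: "a < n" "a \<noteq> j" if "a \<in> S" for a
    using S(1,2) that by auto
  have pc: "p a \<in> carrier_vec r" and qc: "q a \<in> carrier_vec k" if "a < n" for a
    using p q that by (auto simp: generating_points_def)
  have dist: "sqdist (q a) (q b) = sqdist (p a) (p b)
      + (if (a = i \<and> b = j) \<or> (a = j \<and> b = i) then t else 0)" if "a < n" "b < n" for a b
  proof -
    have "sqdist (q a) (q b) = (D + t \<cdot>\<^sub>m E_mat n i j) $$ (a, b)"
      using q that by (simp add: generating_points_def)
    also have "\<dots> = D $$ (a, b) + t * E_mat n i j $$ (a, b)"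
      using that by (simp add: E_mat_def)
    also have "D $$ (a, b) = sqdist (p a) (p b)"
      using p(1) that by (simp add: generating_points_def)
    finally show ?thesis
      using that by (simp add: E_mat_def)
  qed
  obtain c where c: "affine_dependency r p S c" "\<And>a. a \<in> S \<Longrightarrow> c a \<noteq> 0"
    using general_position_dependency[OF pc p(2) S(1,4)] by blast
  have cq: "affine_dependency k q S c"
    by (rule affine_dependency_isometric[OF _ _ _ c(1)]) (simp_all add: lt pc qc dist)
  \<comment> \<open>Go from \<open>p j\<close> to \<open>q j\<close> at the cost of \<open>c i * t\<close>, and back through point \<open>m\<close> at no cost.\<close>
  have "(\<Sum>a\<in>S. c a * sqdist (p a) (p j)) + c i * t = (\<Sum>a\<in>S. c a * sqdist (q a) (q j))"
  proof -
    have "(\<Sum>a\<in>S. c a * sqdist (q a) (q j)) =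
          (\<Sum>a\<in>S. c a * sqdist (p a) (p j) + (if a = i then c i * t else 0))"
      using ij by (intro sum.cong) (auto simp: lt dist algebra_simps)
    then show ?thesis
      using S(3) by (simp add: sum.distrib S_def)
  qed
  also have "\<dots> = (\<Sum>a\<in>S. c a * sqdist (q a) (q m))"
    using lt m ij qc cq by (intro affine_dependency_sqdist_const) (auto simp: S_def)
  also have "\<dots> = (\<Sum>a\<in>S. c a * sqdist (p a) (p m))"
    using m ij by (intro sum.cong) (auto simp: lt dist S_def)
  also have "\<dots> = (\<Sum>a\<in>S. c a * sqdist (p a) (p j))"
    using lt m ij pc c(1) by (intro affine_dependency_sqdist_const) (auto simp: S_def)
  finally show ?thesis
    using c(2)[of i] by (simp add: S_def)
qed

theorem corollary3p2:
  fixes D :: "real mat" and n r :: nat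
  assumes "is_EDM n D"
    and "has_embedding_dim n D r"
    and "r + 3 \<le> n"
    and "EDM_in_general_position n D r"
  shows "\<forall>i<n. \<forall>j<n. i \<noteq> j \<longrightarrow> unyielding n D i j"
proof (intro allI impI)
  fix i j assume ij: "i < n" "j < n" "i \<noteq> j"
  obtain p where p: "generating_points n D r p" "in_general_position n r p"
    using assms(4) by (auto simp: EDM_in_general_position_def)
  have "D + 0 \<cdot>\<^sub>m E_mat n i j = D"
    using p(1) by (auto simp: generating_points_def E_mat_def)
  with assms(1) have "is_EDM n (D + 0 \<cdot>\<^sub>m E_mat n i j)"
    by metis
  moreover have "t = 0" if "is_EDM n (D + t \<cdot>\<^sub>m E_mat n i j)" for t
    using that general_position_perturbation_zero[OF p assms(3) ij] unfolding is_EDM_def by blast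
  ultimately have "is_EDM n (D + t \<cdot>\<^sub>m E_mat n i j) \<longleftrightarrow> 0 \<le> t \<and> t \<le> 0" for t
    using order_antisym[of 0 t] by blast
  then have "yielding_interval n D i j 0 0"
    unfolding yielding_interval_def by blast
  then show "unyielding n D i j"
    unfolding unyielding_def by blast
qed

end
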